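(* Consider the real $3\times3$ matrices $$R=\begin{bmatrix}1&0&0\\0&-1&0\\0&0&-1\end{bmatrix},\quad C=\begin{bmatrix}0&1&0\\0&0&1\\1&0&0\end{bmatrix},\quad \kappa=\begin{bmatrix}1&0&0\\0&0&1\\0&1&0\end{bmatrix},\quad T=\begin{bmatrix}0&1&0\\-1&0&0\\0&0&1\end{bmatrix}$$ acting on $\mathbb{C}^3\cong\mathbb{R}^6$, and the matrix groups $\langle\mathbb{T},\kappa\rangle=\langle R,C,\kappa\rangle$, $\mathbb{O}=\langle C,T\rangle$ and $\langle\mathbb{O},-Id\rangle=\langle C,T,-Id\rangle$. For $\Gamma$ any one of these three groups, let $\Gamma\times\mathbb{S}^1$ denote the group of matrices obtained by adding to $\Gamma$ the elements $e^{i\theta}Id$, $\theta\in[0,2\pi)$. Then the three matrix groups $\langle\mathbb{T},\kappa\rangle\times\mathbb{S}^1$, $\mathbb{O}\times\mathbb{S}^1$ and $\langle\mathbb{O},-Id\rangle\times\mathbb{S}^1$ coincide as subgroups of $\mathbf{O}(6)$. However, the representations $\tilde\rho_1$ and $\tilde\rho_2$ of $S_4\times\mathbb{S}^1$ on $\mathbb{C}^3$, with images $\langle\mathbb{T},\kappa\rangle\times\mathbb{S}^1$ and $\mathbb{O}\times\mathbb{S}^1$ respectively, are not equivalent.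
   Context: $S_4$ is the symmetric group. $\rho_1$ is the representation of $S_4$ on $\mathbb{C}^3$ with image $\langle\mathbb{T},\kappa\rangle$ determined by $\rho_1((234))=C$, $\rho_1((12)(34))=R$, $\rho_1((34))=\kappa$ (permutations of the vertices $V_1=(1,1,1)$, $V_2=(1,-1,-1)$, $V_3=(-1,-1,1)$, $V_4=(-1,1,-1)$ of a tetrahedron). $\rho_2$ is the representation of $S_4$ on $\mathbb{C}^3$ with image $\mathbb{O}$ determined by $\rho_2((234))=C$, $\rho_2((1243))=T$ (permutations of the pairs $\pm P_j$ of opposite vertices of a cube, $P_1=(1,1,1)$, $P_2=TP_1$, $P_4=TP_2$, $P_3=TP_4$). The extended representations are $\tilde\rho_j(\delta,\theta)=e^{i\theta}\rho_j(\delta)$ for $(\delta,\theta)\in S_4\times\mathbb{S}^1$, $j=1,2$. *)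

theory Defs
  imports "HOL-Analysis.Analysis" "HOL-Algebra.Algebra" "HOL-Library.Real_Mod"
begin

section \<open>Matrix groups\<close>

definition GL_group :: "('a::field ^ 'n ^ 'n) monoid" where
  "GL_group = \<lparr>carrier = {A. invertible A}, mult = (**), one = mat 1\<rparr>"

definition orthogonal_group :: "(real ^ 'n ^ 'n) monoid" where
  "orthogonal_group = \<lparr>carrier = {A. orthogonal_matrix A}, mult = (**), one = mat 1\<rparr>"

lemma group_GL_group: "group (GL_group :: ('a::field ^ 'n ^ 'n) monoid)"
proof (rule groupI)
  show "x \<otimes>\<^bsub>GL_group\<^esub> y \<in> carrier GL_group"
    if "x \<in> carrier GL_group" "y \<in> carrier GL_group" for x y :: "'a ^ 'n ^ 'n"
    using that by (simp add: GL_group_def invertible_mult)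
  show "\<exists>y\<in>carrier GL_group. y \<otimes>\<^bsub>GL_group\<^esub> x = \<one>\<^bsub>GL_group\<^esub>"
    if "x \<in> carrier GL_group" for x :: "'a ^ 'n ^ 'n"
    using that by (auto simp: GL_group_def invertible_def)
qed (auto simp: GL_group_def matrix_mul_assoc invertible_def intro: exI[of _ "mat 1"])

lemma group_orthogonal_group: "group (orthogonal_group :: (real ^ 'n ^ 'n) monoid)"
proof (rule groupI)
  show "\<exists>y\<in>carrier orthogonal_group. y \<otimes>\<^bsub>orthogonal_group\<^esub> x = \<one>\<^bsub>orthogonal_group\<^esub>"
    if "x \<in> carrier orthogonal_group" for x :: "real ^ 'n ^ 'n"
    using that by (intro bexI[of _ "Finite_Cartesian_Product.transpose x"])
      (auto simp: orthogonal_group_def orthogonal_matrix_def)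
qed (auto simp: orthogonal_group_def matrix_mul_assoc orthogonal_matrix_mul orthogonal_matrix_id)

definition R_mat :: "real ^ 3 ^ 3" where
  "R_mat = vector [vector [1, 0, 0], vector [0, -1, 0], vector [0, 0, -1]]"

definition C_mat :: "real ^ 3 ^ 3" where
  "C_mat = vector [vector [0, 1, 0], vector [0, 0, 1], vector [1, 0, 0]]"

definition kappa_mat :: "real ^ 3 ^ 3" where
  "kappa_mat = vector [vector [1, 0, 0], vector [0, 0, 1], vector [0, 1, 0]]"

definition T_mat :: "real ^ 3 ^ 3" where
  "T_mat = vector [vector [0, 1, 0], vector [-1, 0, 0], vector [0, 0, 1]]"

abbreviation cmat :: "real ^ 'n ^ 'n \<Rightarrow> complex ^ 'n ^ 'n" where
  "cmat \<equiv> map_matrix complex_of_real"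

definition tetra_kappa :: "(complex ^ 3 ^ 3) set" where
  "tetra_kappa = generate GL_group {cmat R_mat, cmat C_mat, cmat kappa_mat}"

definition octa :: "(complex ^ 3 ^ 3) set" where
  "octa = generate GL_group {cmat C_mat, cmat T_mat}"

definition octa_minus :: "(complex ^ 3 ^ 3) set" where
  "octa_minus = generate GL_group {cmat C_mat, cmat T_mat, - mat 1}"

text \<open>The matrix group \<open>\<Gamma> \<times> S\<^sup>1\<close> (a group generated by matrices, not an
  abstract direct product); \<^term>\<open>mat (cis \<theta>)\<close> is the scalar matrix \<open>e\<^sup>i\<^sup>\<theta> Id\<close>.\<close>

definition adjoin_circle :: "(complex ^ 'n ^ 'n) set \<Rightarrow> (complex ^ 'n ^ 'n) set" where
  "adjoin_circle \<Gamma> = generate GL_group (\<Gamma> \<union> {mat (cis \<theta>) | \<theta>. \<theta> \<in> {0..<2 * pi}})"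


section \<open>The identification of \<open>\<complex>\<^sup>n\<close> with \<open>\<real>\<^sup>2\<^sup>n\<close>\<close>

text \<open>The index type \<^typ>\<open>'n + 'n\<close> lists the real parts first and then the imaginary parts.\<close>

definition realify_vec :: "complex ^ 'n \<Rightarrow> real ^ ('n + 'n)" where
  "realify_vec z = (\<chi> k. case k of Inl i \<Rightarrow> Re (z $ i) | Inr i \<Rightarrow> Im (z $ i))"

definition realify :: "complex ^ 'n ^ 'n \<Rightarrow> real ^ ('n + 'n) ^ ('n + 'n)" where
  "realify A = (\<chi> k l. case k of
      Inl i \<Rightarrow> (case l of Inl j \<Rightarrow> Re (A $ i $ j) | Inr j \<Rightarrow> - Im (A $ i $ j))
    | Inr i \<Rightarrow> (case l of Inl j \<Rightarrow> Im (A $ i $ j) | Inr j \<Rightarrow> Re (A $ i $ j)))"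

lemma sum_UNIV_Plus:
  fixes f :: "'a::finite + 'b::finite \<Rightarrow> 'c::comm_monoid_add"
  shows "sum f UNIV = (\<Sum>i\<in>UNIV. f (Inl i)) + (\<Sum>i\<in>UNIV. f (Inr i))"
  by (simp add: UNIV_Plus_UNIV[symmetric] sum.Plus del: UNIV_Plus_UNIV)

lemma realify_mult_vec: "realify A *v realify_vec z = realify_vec (A *v z)"
  by (simp add: vec_eq_iff realify_def realify_vec_def matrix_vector_mult_def sum_UNIV_Plus
      sum_subtractf sum.distrib sum_negf algebra_simps split: sum.split)

lemma bij_realify_vec: "bij realify_vec"
proof (rule bij_betw_byWitness)
  show "\<forall>z\<in>UNIV. (\<lambda>x. \<chi> i. Complex (x $ Inl i) (x $ Inr i)) (realify_vec z) = z"
    by (simp add: realify_vec_def vec_eq_iff)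
  show "\<forall>x\<in>UNIV. realify_vec (\<chi> i. Complex (x $ Inl i) (x $ Inr i)) = x"
    by (simp add: realify_vec_def vec_eq_iff split: sum.split)
qed auto


section \<open>Representations\<close>

definition is_matrix_rep :: "('g, 'm) monoid_scheme \<Rightarrow> ('g \<Rightarrow> 'a::field ^ 'n ^ 'n) \<Rightarrow> bool" where
  "is_matrix_rep G \<rho> \<longleftrightarrow> group G \<and> \<rho> \<in> hom G GL_group"

definition equivalent_reps ::
  "('g, 'm) monoid_scheme \<Rightarrow> ('g \<Rightarrow> 'a::field ^ 'n ^ 'n) \<Rightarrow> ('g \<Rightarrow> 'a ^ 'n ^ 'n) \<Rightarrow> bool" where
  "equivalent_reps G \<rho> \<sigma> \<longleftrightarrow>
    (\<exists>L. invertible L \<and> (\<forall>g\<in>carrier G. L ** \<rho> g = \<sigma> g ** L))"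

text \<open>The circle \<open>S\<^sup>1 = \<real> / 2\<pi>\<int>\<close>, elements being angles.\<close>

definition circle_group :: "real monoid" where
  "circle_group = \<lparr>carrier = {0..<2 * pi}, mult = (\<lambda>s t. (s + t) rmod (2 * pi)), one = 0\<rparr>"

lemma group_circle_group: "group circle_group"
proof (rule groupI)
  show "x \<otimes>\<^bsub>circle_group\<^esub> y \<otimes>\<^bsub>circle_group\<^esub> z = x \<otimes>\<^bsub>circle_group\<^esub> (y \<otimes>\<^bsub>circle_group\<^esub> z)"
    if "x \<in> carrier circle_group" "y \<in> carrier circle_group" "z \<in> carrier circle_group" for x y z
  proof -
    have "((x + y) rmod (2 * pi) + z) rmod (2 * pi) = (x + y + z) rmod (2 * pi)"
      by (metis rmod_add rmod_rmod)
    moreover have "(x + (y + z) rmod (2 * pi)) rmod (2 * pi) = (x + (y + z)) rmod (2 * pi)"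
      by (metis rmod_add rmod_rmod)
    ultimately show ?thesis by (simp add: circle_group_def add.assoc)
  qed
  show "\<exists>y\<in>carrier circle_group. y \<otimes>\<^bsub>circle_group\<^esub> x = \<one>\<^bsub>circle_group\<^esub>"
    if "x \<in> carrier circle_group" for x
  proof (cases "x = 0")
    case True then show ?thesis using that by (auto simp: circle_group_def)
  next
    case False
    then show ?thesis using that
      by (intro bexI[of _ "2 * pi - x"]) (auto simp: circle_group_def)
  qed
qed (auto simp: circle_group_def rmod_nonneg rmod_less)

abbreviation S4_circle :: "((nat \<Rightarrow> nat) \<times> real) monoid" where
  "S4_circle \<equiv> sym_group 4 \<times>\<times> circle_group"

definition extend_rep :: "((nat \<Rightarrow> nat) \<Rightarrow> complex ^ 3 ^ 3) \<Rightarrow> (nat \<Rightarrow> nat) \<times> real \<Rightarrow> complex ^ 3 ^ 3"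
  where "extend_rep \<rho> = (\<lambda>(\<delta>, \<theta>). mat (cis \<theta>) ** \<rho> \<delta>)"

text \<open>Permutations are composed from right to left. The values on generators determine the
  two representations; that they exist is proved in \<open>ex_is_rho1\<close> and \<open>ex_is_rho2\<close>.\<close>

definition is_rho1 :: "((nat \<Rightarrow> nat) \<Rightarrow> complex ^ 3 ^ 3) \<Rightarrow> bool" where
  "is_rho1 \<rho> \<longleftrightarrow> is_matrix_rep (sym_group 4) \<rho>
    \<and> \<rho> (cycle_of_list [2, 3, 4]) = cmat C_mat
    \<and> \<rho> (cycle_of_list [1, 2] \<circ> cycle_of_list [3, 4]) = cmat R_mat
    \<and> \<rho> (cycle_of_list [3, 4]) = cmat kappa_mat"

definition is_rho2 :: "((nat \<Rightarrow> nat) \<Rightarrow> complex ^ 3 ^ 3) \<Rightarrow> bool" where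
  "is_rho2 \<rho> \<longleftrightarrow> is_matrix_rep (sym_group 4) \<rho>
    \<and> \<rho> (cycle_of_list [2, 3, 4]) = cmat C_mat
    \<and> \<rho> (cycle_of_list [1, 2, 4, 3]) = cmat T_mat"


subsection \<open>Existence\<close>

text \<open>If \<open>W\<^sub>1, \<dots>, W\<^sub>4\<close> are the vertices of a tetrahedron, then \<open>perm_mat W \<sigma>\<close> is the linear
  map sending \<open>W\<^sub>i\<close> to \<open>W\<^bsub>\<sigma> i\<^esub>\<close>.\<close>

definition perm_mat :: "(nat \<Rightarrow> complex ^ 3) \<Rightarrow> (nat \<Rightarrow> nat) \<Rightarrow> complex ^ 3 ^ 3" where
  "perm_mat W \<sigma> = (\<chi> a b. (\<Sum>i\<in>{1..4}. W (\<sigma> i) $ a * W i $ b) / 4)"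

definition tetrahedral :: "(nat \<Rightarrow> complex ^ 3) \<Rightarrow> bool" where
  "tetrahedral W \<longleftrightarrow> (\<forall>i\<in>{1..4}. \<forall>j\<in>{1..4}. (\<Sum>c\<in>UNIV. W i $ c * W j $ c) = (if i = j then 4 else 0) - 1)
     \<and> (\<forall>a. (\<Sum>i\<in>{1..4}. W i $ a) = 0) \<and> perm_mat W id = mat 1"

lemma perm_mat_comp:
  assumes W: "tetrahedral W" and s: "\<sigma> permutes {1..4}" and t: "\<tau> permutes {1..4}"
  shows "perm_mat W (\<sigma> \<circ> \<tau>) = perm_mat W \<sigma> ** perm_mat W \<tau>"
proof -
  have z: "(\<Sum>i\<in>{1..4}. W (\<sigma> i) $ a) = 0" for a
    using sum.permute[OF s, of "\<lambda>i. W i $ a"] W by (simp add: tetrahedral_def)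
  have "(perm_mat W \<sigma> ** perm_mat W \<tau>) $ a $ b = perm_mat W (\<sigma> \<circ> \<tau>) $ a $ b" for a b
  proof -
    have "(perm_mat W \<sigma> ** perm_mat W \<tau>) $ a $ b
       = (\<Sum>c\<in>UNIV. (\<Sum>i\<in>{1..4}. W (\<sigma> i) $ a * W i $ c) * (\<Sum>j\<in>{1..4}. W (\<tau> j) $ c * W j $ b)) / 16"
      unfolding perm_mat_def matrix_matrix_mult_def
      by (simp add: sum_divide_distrib[of _ "UNIV :: 3 set"])
    also have "\<dots>
       = (\<Sum>c\<in>UNIV. \<Sum>j\<in>{1..4}. \<Sum>i\<in>{1..4}. W (\<sigma> i) $ a * (W i $ c * W (\<tau> j) $ c) * W j $ b) / 16"
    proof -
      have "(\<Sum>i\<in>{1..4}. W (\<sigma> i) $ a * W i $ c) * (\<Sum>j\<in>{1..4}. W (\<tau> j) $ c * W j $ b)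
        = (\<Sum>j\<in>{1..4}. \<Sum>i\<in>{1..4}. W (\<sigma> i) $ a * (W i $ c * W (\<tau> j) $ c) * W j $ b)" for c
        unfolding sum_product by (subst sum.swap) (simp only: mult.assoc)
      then show ?thesis by simp
    qed
    also have "\<dots> = (\<Sum>j\<in>{1..4}. \<Sum>i\<in>{1..4}. W (\<sigma> i) $ a * (\<Sum>c\<in>UNIV. W i $ c * W (\<tau> j) $ c) * W j $ b) / 16"
    proof -
      have "(\<Sum>c\<in>UNIV. \<Sum>i\<in>{1..4}. W (\<sigma> i) $ a * (W i $ c * W (\<tau> j) $ c) * W j $ b)
        = (\<Sum>i\<in>{1..4}. W (\<sigma> i) $ a * (\<Sum>c\<in>UNIV. W i $ c * W (\<tau> j) $ c) * W j $ b)" for j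
        by (subst sum.swap) (simp only: sum_distrib_left sum_distrib_right)
      then show ?thesis by (subst sum.swap) simp
    qed
    also have "\<dots> = (\<Sum>j\<in>{1..4}. 4 * W (\<sigma> (\<tau> j)) $ a * W j $ b) / 16"
    proof -
      have "(\<Sum>i\<in>{1..4}. W (\<sigma> i) $ a * (\<Sum>c\<in>UNIV. W i $ c * W (\<tau> j) $ c) * W j $ b)
          = 4 * W (\<sigma> (\<tau> j)) $ a * W j $ b" if j: "j \<in> {1..4}" for j
      proof -
        have tj: "\<tau> j \<in> {1..4}" using t j by (metis permutes_in_image)
        have "(\<Sum>i\<in>{1..4}. W (\<sigma> i) $ a * (\<Sum>c\<in>UNIV. W i $ c * W (\<tau> j) $ c) * W j $ b)
          = (\<Sum>i\<in>{1..4}. (if i = \<tau> j then 4 * W (\<sigma> i) $ a * W j $ b else 0) - W (\<sigma> i) $ a * W j $ b)"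
        proof (intro sum.cong refl)
          fix i :: nat assume "i \<in> {1..4}"
          with W tj have "(\<Sum>c\<in>UNIV. W i $ c * W (\<tau> j) $ c) = (if i = \<tau> j then 4 else 0) - 1"
            unfolding tetrahedral_def by blast
          then show "W (\<sigma> i) $ a * (\<Sum>c\<in>UNIV. W i $ c * W (\<tau> j) $ c) * W j $ b
            = (if i = \<tau> j then 4 * W (\<sigma> i) $ a * W j $ b else 0) - W (\<sigma> i) $ a * W j $ b"
            by (simp only:) (simp add: left_diff_distrib right_diff_distrib)
        qed
        also have "\<dots> = 4 * W (\<sigma> (\<tau> j)) $ a * W j $ b - (\<Sum>i\<in>{1..4}. W (\<sigma> i) $ a) * W j $ b"
          using tj by (simp only: sum_subtractf sum.delta finite_atLeastAtMost sum_distrib_right if_True)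
        finally show ?thesis using z by simp
      qed
      then show ?thesis by (intro arg_cong[of _ _ "\<lambda>x. x / 16"] sum.cong refl)
    qed
    also have "\<dots> = perm_mat W (\<sigma> \<circ> \<tau>) $ a $ b"
      by (simp add: perm_mat_def sum_divide_distrib mult.commute)
    finally show ?thesis .
  qed
  then show ?thesis by (simp add: vec_eq_iff)
qed

lemma perm_mat_rep:
  assumes W: "tetrahedral W"
  shows "is_matrix_rep (sym_group 4) (perm_mat W)"
proof -
  have "invertible (perm_mat W \<sigma>)" if s: "\<sigma> permutes {1..4}" for \<sigma>
    unfolding invertible_def
    using perm_mat_comp[OF W s permutes_inv[OF s]] perm_mat_comp[OF W permutes_inv[OF s] s] W
      permutes_inv_o[OF s] by (intro exI[of _ "perm_mat W (inv' \<sigma>)"]) (simp add: tetrahedral_def)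
  then show ?thesis
    using perm_mat_comp[OF W]
    by (auto simp: is_matrix_rep_def sym_group_is_group hom_def sym_group_carrier sym_group_mult
        GL_group_def)
qed

lemma sign_twist_rep:
  assumes "is_matrix_rep (sym_group 4) \<rho>"
  shows "is_matrix_rep (sym_group 4) (\<lambda>\<sigma>. mat (of_int (sign \<sigma>)) ** (\<rho> \<sigma> :: complex ^ 3 ^ 3))"
proof -
  have mc: "mat c ** A = A ** mat c" for c and A :: "complex ^ 3 ^ 3"
    by (simp add: vec_eq_iff forall_3 sum_3 matrix_matrix_mult_def mat_def)
  have mm: "mat (c * d) = (mat c ** mat d :: complex ^ 3 ^ 3)" for c d
    by (simp add: vec_eq_iff forall_3 sum_3 matrix_matrix_mult_def mat_def)
  have inv: "invertible (mat (of_int (sign \<sigma>)) :: complex ^ 3 ^ 3)" for \<sigma> :: "nat \<Rightarrow> nat"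
    unfolding invertible_def
    by (rule exI[of _ "mat (of_int (sign \<sigma>))"]) (simp add: mm[symmetric] sign_def)
  have "\<rho> \<in> hom (sym_group 4) GL_group"
    using assms by (simp add: is_matrix_rep_def)
  then have rho: "\<And>\<sigma>. \<sigma> \<in> carrier (sym_group 4) \<Longrightarrow> invertible (\<rho> \<sigma>)"
    "\<And>\<sigma> \<tau>. \<sigma> \<in> carrier (sym_group 4) \<Longrightarrow> \<tau> \<in> carrier (sym_group 4) \<Longrightarrow> \<rho> (\<sigma> \<circ> \<tau>) = \<rho> \<sigma> ** \<rho> \<tau>"
    by (auto simp: hom_def GL_group_def sym_group_mult)
  have "mat (of_int (sign (\<sigma> \<circ> \<tau>))) ** \<rho> (\<sigma> \<circ> \<tau>)
      = (mat (of_int (sign \<sigma>)) ** \<rho> \<sigma>) ** (mat (of_int (sign \<tau>)) ** \<rho> \<tau>)"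
    if "\<sigma> \<in> carrier (sym_group 4)" "\<tau> \<in> carrier (sym_group 4)" for \<sigma> \<tau>
  proof -
    have "sign (\<sigma> \<circ> \<tau>) = sign \<sigma> * sign \<tau>"
      using that by (intro sign_compose sym_group_carrier')
    then have "mat (of_int (sign (\<sigma> \<circ> \<tau>))) ** \<rho> (\<sigma> \<circ> \<tau>)
      = (mat (of_int (sign \<sigma>)) ** mat (of_int (sign \<tau>))) ** (\<rho> \<sigma> ** \<rho> \<tau>)"
      using that by (simp only: rho of_int_mult mm)
    also have "\<dots> = mat (of_int (sign \<sigma>)) ** ((mat (of_int (sign \<tau>)) ** \<rho> \<sigma>) ** \<rho> \<tau>)"
      by (simp only: matrix_mul_assoc)
    also have "\<dots> = mat (of_int (sign \<sigma>)) ** ((\<rho> \<sigma> ** mat (of_int (sign \<tau>))) ** \<rho> \<tau>)"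
      by (simp only: mc)
    finally show ?thesis by (simp only: matrix_mul_assoc)
  qed
  moreover have "invertible (mat (of_int (sign \<sigma>)) ** \<rho> \<sigma>)" if "\<sigma> \<in> carrier (sym_group 4)" for \<sigma>
    by (rule invertible_mult[OF inv rho(1)[OF that]])
  ultimately show ?thesis
    unfolding is_matrix_rep_def hom_def sym_group_mult
    by (intro conjI sym_group_is_group CollectI Pi_I ballI) (simp_all add: GL_group_def)
qed

lemma atLeastAtMost_1_4: "{Suc 0..4} = {1, 2, 3, 4}"
  by auto

text \<open>The vertices \<open>V\<^sub>1, \<dots>, V\<^sub>4\<close>, and the same vertices relabelled as
  \<open>P\<^sub>1, - P\<^sub>2, - P\<^sub>3, P\<^sub>4\<close>, where \<open>\<plusminus> P\<^sub>j\<close> are the vertices of the cube.\<close>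

definition tetra_V :: "nat \<Rightarrow> complex ^ 3" where
  "tetra_V i = (if i = 1 then vector [1, 1, 1] else if i = 2 then vector [1, -1, -1]
    else if i = 3 then vector [-1, -1, 1] else vector [-1, 1, -1])"

definition tetra_P :: "nat \<Rightarrow> complex ^ 3" where
  "tetra_P i = (if i = 1 then vector [1, 1, 1] else if i = 2 then vector [-1, 1, -1]
    else if i = 3 then vector [1, -1, -1] else vector [-1, -1, 1])"

lemma tetrahedral_V: "tetrahedral tetra_V"
  by (simp add: tetrahedral_def atLeastAtMost_1_4 tetra_V_def perm_mat_def vec_eq_iff forall_3
      sum_3 mat_def)

lemma tetrahedral_P: "tetrahedral tetra_P"
  by (simp add: tetrahedral_def atLeastAtMost_1_4 tetra_P_def perm_mat_def vec_eq_iff forall_3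
      sum_3 mat_def)

lemma ex_is_rho1: "\<exists>\<rho>. is_rho1 \<rho>"
  unfolding is_rho1_def
  by (intro exI[of _ "perm_mat tetra_V"])
    (simp add: perm_mat_rep tetrahedral_V atLeastAtMost_1_4 tetra_V_def perm_mat_def vec_eq_iff
      forall_3 map_matrix_def C_mat_def R_mat_def kappa_mat_def Transposition.transpose_def)

lemma sign_cycles:
  "sign (cycle_of_list [2, 3, 4::nat]) = 1" "sign (cycle_of_list [1, 2, 4, 3::nat]) = - 1"
  by (simp_all add: sign_compose permutation_swap_id permutation_compose sign_swap_id sign_id)

lemma ex_is_rho2: "\<exists>\<rho>. is_rho2 \<rho>"
  unfolding is_rho2_def
  by (intro exI[of _ "\<lambda>\<sigma>. mat (of_int (sign \<sigma>)) ** perm_mat tetra_P \<sigma>"] conjI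
        sign_twist_rep perm_mat_rep tetrahedral_P; unfold sign_cycles)
    (simp_all add: atLeastAtMost_1_4 tetra_P_def perm_mat_def vec_eq_iff matrix_matrix_mult_def
      sum_3 mat_def forall_3 map_matrix_def C_mat_def T_mat_def Transposition.transpose_def)

end

theory Submission
  imports Defs
begin

text \<open>Since \<open>- Id = e\<^sup>i\<^sup>\<pi> Id\<close> lies on the circle, \<open>R = C C T T C\<close>, \<open>- \<kappa> = T C C T T\<close> and
  \<open>- T = \<kappa> C R\<close> show that the three groups coincide. On the other hand, \<open>(1243) = (12)(34) (234) (34)\<close>,
  so \<open>\<rho>\<^sub>1\<close> maps \<open>(1243)\<close> to \<open>R C \<kappa>\<close>, of trace \<open>- 1\<close>, whereas \<open>\<rho>\<^sub>2\<close> maps it to \<open>T\<close>, of trace \<open>1\<close>.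
  Passing from \<open>\<complex>\<^sup>3\<close> to \<open>\<real>\<^sup>6\<close> replaces the trace by twice its real part, so the characters differ
  over \<open>\<real>\<close> as well as over \<open>\<complex>\<close>.\<close>

section \<open>Matrices\<close>

text \<open>The record fields are extracted one by one, so that \<open>carrier\<close>,
  \<open>mult\<close> and \<open>one\<close> simplify while the group constant itself stays folded
  in statements about subgroups and generation.\<close>

lemmas GL_group_simps = GL_group_def[THEN arg_cong, of carrier, simplified]
  GL_group_def[THEN arg_cong, of mult, simplified] GL_group_def[THEN arg_cong, of one, simplified]

lemmas orthogonal_group_simps = orthogonal_group_def[THEN arg_cong, of carrier, simplified]
  orthogonal_group_def[THEN arg_cong, of mult, simplified]
  orthogonal_group_def[THEN arg_cong, of one, simplified]

lemma mat_mult_nth: "(mat c ** A) $ i $ j = c * A $ i $ j"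
  for A :: "'a::semiring_1 ^ 'm ^ 'n"
  by (simp add: matrix_matrix_mult_def mat_def mult_delta_left)

lemma mult_mat_nth: "(A ** mat c) $ i $ j = A $ i $ j * c"
  for A :: "'a::semiring_1 ^ 'n ^ 'm"
  by (simp add: matrix_matrix_mult_def mat_def mult_delta_right)

lemma mat_mult_mat: "mat c ** mat d = (mat (c * d) :: 'a::semiring_1 ^ 'n ^ 'n)"
  by (simp add: vec_eq_iff mat_mult_nth) (simp add: mat_def)

lemma invertible_mat_one: "invertible (mat 1 :: 'a::semiring_1 ^ 'n ^ 'n)"
  unfolding invertible_def by (rule exI[of _ "mat 1"]) simp

lemma mat_mult_commute: "mat c ** A = A ** mat c" for A :: "'a::comm_semiring_1 ^ 'n ^ 'n"
  by (simp add: vec_eq_iff mat_mult_nth mult_mat_nth mult.commute)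

lemma mat_minus_one_mult: "mat (- 1) ** A = - A" for A :: "'a::ring_1 ^ 'n ^ 'n"
  by (simp add: vec_eq_iff mat_mult_nth)

lemma uminus_mat: "- mat c = (mat (- c) :: 'a::ring_1 ^ 'n ^ 'n)"
  by (simp add: vec_eq_iff mat_def)

lemma cmat_mult: "cmat (A ** B) = cmat A ** cmat B"
  by (simp add: vec_eq_iff map_matrix_def matrix_matrix_mult_def)

lemma cmat_one: "cmat (mat 1) = mat 1"
  by (simp add: vec_eq_iff map_matrix_def mat_def)

lemma cmat_uminus: "cmat (- A) = - cmat A"
  by (simp add: vec_eq_iff map_matrix_def)

section \<open>Real forms of complex matrices and orthogonality\<close>

lemma realify_mult: "realify (A ** B) = realify A ** realify B"
  by (simp add: vec_eq_iff realify_def matrix_matrix_mult_def sum_UNIV_Plus sum_subtractf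
      sum.distrib sum_negf algebra_simps split: sum.split)

lemma realify_one: "realify (mat 1) = mat 1"
  by (auto simp: vec_eq_iff realify_def mat_def split: sum.split)

text \<open>Both diagonal blocks of the real form are the real part of \<open>A\<close>.\<close>

lemma trace_realify: "trace (realify A) = 2 * Re (trace A)"
  by (simp add: trace_def realify_def sum_UNIV_Plus)

lemma invertible_realify:
  assumes "invertible A"
  shows "invertible (realify A)"
  using assms unfolding invertible_def by (metis realify_mult realify_one)

lemma invertible_cmat:
  assumes "orthogonal_matrix A"
  shows "invertible (cmat A)"
  using assms unfolding orthogonal_matrix_def invertible_def by (metis cmat_mult cmat_one)

text \<open>For a real matrix the off-diagonal blocks of the real form vanish, so transposition
  commutes with \<open>realify\<close>.\<close>

lemma orthogonal_realify_cmat: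
  assumes "orthogonal_matrix A"
  shows "orthogonal_matrix (realify (cmat A))"
proof -
  have "Finite_Cartesian_Product.transpose (realify (cmat A))
    = realify (cmat (Finite_Cartesian_Product.transpose A))"
    by (simp add: vec_eq_iff realify_def map_matrix_def Finite_Cartesian_Product.transpose_def
        split: sum.split)
  then show ?thesis
    using assms by (simp add: orthogonal_matrix_def flip: realify_mult cmat_mult)
      (simp add: cmat_one realify_one)
qed

lemma invertible_mat_cis: "invertible (mat (cis \<theta>) :: complex ^ 'n ^ 'n)"
  unfolding invertible_def
  by (rule exI[of _ "mat (cis (- \<theta>))"]) (simp add: mat_mult_mat cis_mult)

lemma orthogonal_realify_cis:
  "orthogonal_matrix (realify (mat (cis \<theta>) :: complex ^ 'n ^ 'n))"
proof -
  \<comment> \<open>Transposing exchanges the two off-diagonal blocks and so changes the sign of the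
    imaginary part: the scalar is conjugated.\<close>
  have "Finite_Cartesian_Product.transpose (realify (mat (cis \<theta>) :: complex ^ 'n ^ 'n)) = realify (mat (cis (- \<theta>)))"
    by (auto simp: vec_eq_iff realify_def mat_def Finite_Cartesian_Product.transpose_def
        split: sum.split)
  then show ?thesis
    by (simp add: orthogonal_matrix_def mat_mult_mat cis_mult realify_one flip: realify_mult)
qed

text \<open>This is the unitary group \<open>U(n)\<close>, described by its real form because the
  ambient group of interest is the real orthogonal group; invertibility is recorded to give
  membership in \<open>GL_group\<close>.\<close>

definition unitary_matrices :: "(complex ^ 'n ^ 'n) set" where
  "unitary_matrices = {A. invertible A \<and> orthogonal_matrix (realify A)}"

text \<open>Multiplicativity of \<open>realify\<close> carries over closure under products. For
  inverses, the real form of the inverse is an orthogonal left inverse, hence the inverse in the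
  orthogonal group.\<close>

lemma subgroup_realify_image:
  assumes H: "subgroup H GL_group" and U: "H \<subseteq> unitary_matrices"
  shows "subgroup (realify ` H) orthogonal_group"
proof (rule group.subgroupI[OF group_orthogonal_group])
  show "realify ` H \<subseteq> carrier orthogonal_group"
    using U by (auto simp: orthogonal_group_simps unitary_matrices_def)
  show "realify ` H \<noteq> {}"
    using subgroup.one_closed[OF H] by auto
  show "inv\<^bsub>orthogonal_group\<^esub> x \<in> realify ` H" if x: "x \<in> realify ` H" for x
  proof -
    obtain A where A: "A \<in> H" "x = realify A" using x by auto
    let ?B = "inv\<^bsub>GL_group\<^esub> A"
    have B: "?B \<in> H" by (rule subgroup.m_inv_closed[OF H A(1)])
    have "?B ** A = mat 1"
      using group.l_inv[OF group_GL_group subgroup.mem_carrier[OF H A(1)]]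
      by (simp add: GL_group_simps)
    then have "realify ?B ** x = mat 1"
      by (simp add: A(2) realify_one flip: realify_mult)
    then have "inv\<^bsub>orthogonal_group\<^esub> x = realify ?B"
      using U A B
      by (intro group.inv_equality[OF group_orthogonal_group])
        (auto simp: orthogonal_group_simps unitary_matrices_def)
    then show ?thesis using B by simp
  qed
  show "x \<otimes>\<^bsub>orthogonal_group\<^esub> y \<in> realify ` H" if "x \<in> realify ` H" "y \<in> realify ` H" for x y
    using that subgroup.m_closed[OF H]
    by (auto simp: orthogonal_group_simps GL_group_simps simp flip: realify_mult)
qed

lemma subgroup_unitary_matrices: "subgroup unitary_matrices GL_group"
proof (rule group.subgroupI[OF group_GL_group])
  show "inv\<^bsub>GL_group\<^esub> A \<in> unitary_matrices"
    if A: "A \<in> unitary_matrices" for A :: "complex ^ 'n ^ 'n"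
  proof -
    let ?B = "inv\<^bsub>GL_group\<^esub> A" and ?t = "Finite_Cartesian_Product.transpose (realify A)"
    have c: "A \<in> carrier GL_group" using A by (simp add: GL_group_simps unitary_matrices_def)
    have B: "invertible ?B"
      using group.inv_closed[OF group_GL_group c] by (simp add: GL_group_simps)
    have "?B ** A = mat 1"
      using group.l_inv[OF group_GL_group c] by (simp add: GL_group_simps)
    then have "realify ?B ** realify A = mat 1"
      by (simp add: realify_one flip: realify_mult)
    moreover have "realify A ** ?t = mat 1"
      using A by (simp add: unitary_matrices_def orthogonal_matrix_def)
    \<comment> \<open>A left and a right inverse of the same matrix coincide, so the real form of
      the inverse is the transpose.\<close>
    ultimately have "realify ?B = ?t"
      using matrix_mul_assoc[of "realify ?B" "realify A" ?t] by simp
    then show ?thesis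
      using A B by (simp add: unitary_matrices_def orthogonal_matrix_def)
  qed
  have "mat 1 \<in> (unitary_matrices :: (complex ^ 'n ^ 'n) set)"
    by (simp add: unitary_matrices_def invertible_mat_one realify_one orthogonal_matrix_id)
  then show "(unitary_matrices :: (complex ^ 'n ^ 'n) set) \<noteq> {}" by blast
qed (simp_all add: GL_group_simps unitary_matrices_def realify_mult orthogonal_matrix_mul
    invertible_mult subset_iff)


section \<open>Adjoining the circle\<close>

lemma subgroup_adjoin_circle:
  assumes "\<Gamma> \<subseteq> carrier GL_group"
  shows "subgroup (adjoin_circle \<Gamma>) GL_group"
  unfolding adjoin_circle_def
  using assms by (intro group.generate_is_subgroup[OF group_GL_group])
    (auto simp: GL_group_simps invertible_mat_cis)

lemma subset_adjoin_circle: "\<Gamma> \<subseteq> adjoin_circle \<Gamma>"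
  unfolding adjoin_circle_def by (auto intro: generate.incl)

lemma subset_adjoin_circle_generate: "S \<subseteq> adjoin_circle (generate GL_group S)"
  unfolding adjoin_circle_def by (auto intro: generate.incl)

lemma adjoin_circle_mult:
  "A \<in> adjoin_circle \<Gamma> \<Longrightarrow> B \<in> adjoin_circle \<Gamma> \<Longrightarrow> A ** B \<in> adjoin_circle \<Gamma>"
  unfolding adjoin_circle_def using generate.eng[of A GL_group _ B] by (simp add: GL_group_simps)

lemma mat_cis_in_adjoin_circle: "\<theta> \<in> {0..<2 * pi} \<Longrightarrow> mat (cis \<theta>) \<in> adjoin_circle \<Gamma>"
  unfolding adjoin_circle_def by (auto intro: generate.incl)

lemma adjoin_circle_uminus:
  assumes "A \<in> adjoin_circle \<Gamma>"
  shows "- A \<in> adjoin_circle \<Gamma>"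
  \<comment> \<open>Negation is multiplication by the circle scalar of angle
    \<open>pi\<close>.\<close>
  using adjoin_circle_mult[OF mat_cis_in_adjoin_circle[of pi] assms]
  by (simp add: mat_minus_one_mult)

lemma adjoin_circle_subset:
  assumes "subgroup H GL_group" "\<Gamma> \<subseteq> H" "\<And>\<theta>. mat (cis \<theta>) \<in> H"
  shows "adjoin_circle \<Gamma> \<subseteq> H"
  unfolding adjoin_circle_def
  using assms by (intro group.generate_subgroup_incl[OF group_GL_group]) auto

lemma adjoin_circle_unitary:
  assumes "\<Gamma> \<subseteq> unitary_matrices"
  shows "adjoin_circle \<Gamma> \<subseteq> unitary_matrices"
  using assms by (intro adjoin_circle_subset subgroup_unitary_matrices)
    (auto simp: unitary_matrices_def invertible_mat_cis orthogonal_realify_cis)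

text \<open>Reduces an inclusion between two circle extensions to finitely many memberships: the
  larger group is a subgroup that already contains every scalar, so only the generators in
  \<open>S\<close> remain.\<close>

lemma adjoin_circle_generate_subset:
  assumes "\<Gamma> \<subseteq> carrier GL_group" "S \<subseteq> adjoin_circle \<Gamma>"
  shows "adjoin_circle (generate GL_group S) \<subseteq> adjoin_circle \<Gamma>"
  unfolding adjoin_circle_def[of "generate GL_group S"]
  using assms
  by (intro group.generate_subgroup_incl[OF group_GL_group] subgroup_adjoin_circle)
    (auto dest: group.generate_subgroup_incl[OF group_GL_group _ subgroup_adjoin_circle]
      intro: mat_cis_in_adjoin_circle)


section \<open>The three groups\<close>

lemmas mat3_simps = R_mat_def C_mat_def kappa_mat_def T_mat_def vec_eq_iff forall_3 sum_3
  matrix_matrix_mult_def mat_def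

lemma orthogonal_generators:
  "orthogonal_matrix R_mat" "orthogonal_matrix C_mat" "orthogonal_matrix kappa_mat"
  "orthogonal_matrix T_mat"
  by (simp_all add: orthogonal_matrix_def Finite_Cartesian_Product.transpose_def mat3_simps)

lemma generators_unitary:
  "cmat R_mat \<in> unitary_matrices" "cmat C_mat \<in> unitary_matrices"
  "cmat kappa_mat \<in> unitary_matrices" "cmat T_mat \<in> unitary_matrices"
  "- mat 1 \<in> (unitary_matrices :: (complex ^ 3 ^ 3) set)"
  \<comment> \<open>The generator \<open>- mat 1\<close> is the circle scalar of angle
    \<open>pi\<close>.\<close>
  using invertible_mat_cis[of pi] orthogonal_realify_cis[of pi]
  by (simp_all add: unitary_matrices_def orthogonal_generators invertible_cmat
      orthogonal_realify_cmat uminus_mat)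

lemma unitary_subset_GL: "unitary_matrices \<subseteq> carrier GL_group"
  by (auto simp: unitary_matrices_def GL_group_simps)

lemma groups_unitary:
  "tetra_kappa \<subseteq> unitary_matrices" "octa \<subseteq> unitary_matrices" "octa_minus \<subseteq> unitary_matrices"
  unfolding tetra_kappa_def octa_def octa_minus_def
  by (intro group.generate_subgroup_incl[OF group_GL_group _ subgroup_unitary_matrices];
      simp add: generators_unitary)+

text \<open>\<open>T_mat ** T_mat\<close> is the half turn about the third axis, and conjugation by
  \<open>C_mat\<close> (whose square is its inverse) moves it to the first axis. The signs are
  forced: words in C and T have determinant 1 but kappa has determinant -1, and the tetrahedral
  rotations contain no quarter turn such as T.\<close>

lemma R_word: "R_mat = C_mat ** C_mat ** T_mat ** T_mat ** C_mat"
  and kappa_word: "kappa_mat = - (T_mat ** C_mat ** C_mat ** T_mat ** T_mat)"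
  and T_word: "T_mat = - (kappa_mat ** C_mat ** R_mat)"
  by (simp_all add: mat3_simps)

text \<open>Each list of generators consists of words in the other up to sign, and the circle
  supplies the sign.\<close>

lemma adjoin_circle_tetra_kappa: "adjoin_circle tetra_kappa = adjoin_circle octa"
proof
  have "{cmat C_mat, cmat T_mat} \<subseteq> adjoin_circle octa"
    using subset_adjoin_circle_generate[of "{cmat C_mat, cmat T_mat}"] unfolding octa_def by simp
  then have "{cmat R_mat, cmat C_mat, cmat kappa_mat} \<subseteq> adjoin_circle octa"
    by (auto simp: R_word kappa_word cmat_mult cmat_uminus intro!: adjoin_circle_mult adjoin_circle_uminus)
  then show "adjoin_circle tetra_kappa \<subseteq> adjoin_circle octa"
    using groups_unitary(2) unitary_subset_GL unfolding tetra_kappa_def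
    by (intro adjoin_circle_generate_subset) auto
  have "{cmat R_mat, cmat C_mat, cmat kappa_mat} \<subseteq> adjoin_circle tetra_kappa"
    using subset_adjoin_circle_generate[of "{cmat R_mat, cmat C_mat, cmat kappa_mat}"] unfolding tetra_kappa_def by simp
  then have "{cmat C_mat, cmat T_mat} \<subseteq> adjoin_circle tetra_kappa"
    by (auto simp: T_word cmat_mult cmat_uminus intro!: adjoin_circle_mult adjoin_circle_uminus)
  then show "adjoin_circle octa \<subseteq> adjoin_circle tetra_kappa"
    using groups_unitary(1) unitary_subset_GL unfolding octa_def
    by (intro adjoin_circle_generate_subset) auto
qed

lemma adjoin_circle_octa_minus: "adjoin_circle octa = adjoin_circle octa_minus"
proof
  have "{cmat C_mat, cmat T_mat} \<subseteq> adjoin_circle octa_minus"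
    using subset_adjoin_circle_generate[of "{cmat C_mat, cmat T_mat, - mat 1}"] unfolding octa_minus_def by simp
  then show "adjoin_circle octa \<subseteq> adjoin_circle octa_minus"
    using groups_unitary(3) unitary_subset_GL unfolding octa_def
    by (intro adjoin_circle_generate_subset) auto
  have "{cmat C_mat, cmat T_mat} \<subseteq> adjoin_circle octa"
    using subset_adjoin_circle_generate[of "{cmat C_mat, cmat T_mat}"] unfolding octa_def by simp
  moreover have "- mat 1 \<in> adjoin_circle octa"
    using mat_cis_in_adjoin_circle[of pi octa] by (simp add: uminus_mat)
  ultimately show "adjoin_circle octa_minus \<subseteq> adjoin_circle octa"
    using groups_unitary(2) unitary_subset_GL unfolding octa_minus_def
    by (intro adjoin_circle_generate_subset) auto
qed


section \<open>Generators of the symmetric group\<close>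

text \<open>Transpositions generate the symmetric group, so it suffices to write the six
  transpositions as words in the three generators.\<close>

lemma generate_sym_group_4_rho1:
  "generate (sym_group 4) {cycle_of_list [2, 3, 4], cycle_of_list [1, 2] \<circ> cycle_of_list [3, 4],
     cycle_of_list [3, 4]} = carrier (sym_group 4)"
  (is "generate ?G {?c, ?r, ?k} = _")
proof
  have S: "{1..4} = {1, 2, 3, 4::nat}" by auto
  have "{?c, ?r, ?k} \<subseteq> carrier ?G"
    by (auto simp: sym_group_carrier intro!: permutes_compose permutes_swap_id)
  then show "generate ?G {?c, ?r, ?k} \<subseteq> carrier ?G"
    by (rule group.generate_incl[OF sym_group_is_group])
  have gen: "?c \<in> generate ?G {?c, ?r, ?k}" "?r \<in> generate ?G {?c, ?r, ?k}"
    "?k \<in> generate ?G {?c, ?r, ?k}"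
    by (rule generate.incl, blast)+
  have mult: "x \<circ> y \<in> generate ?G {?c, ?r, ?k}"
    if "x \<in> generate ?G {?c, ?r, ?k}" "y \<in> generate ?G {?c, ?r, ?k}" for x y
    using generate.eng[OF that] by (simp only: sym_group_mult)
  \<comment> \<open>From c = (23)(34) come (23) = c k and (24) = k c; then (13) = c r (23) and (14)
    = (24) r c.\<close>
  have words: "Transposition.transpose 1 2 = ?k \<circ> ?r"
    "Transposition.transpose 1 3 = ?c \<circ> ?r \<circ> ?c \<circ> ?k"
    "Transposition.transpose 1 4 = ?k \<circ> ?c \<circ> ?r \<circ> ?c"
    "Transposition.transpose 2 3 = ?c \<circ> ?k"
    "Transposition.transpose 2 4 = ?k \<circ> ?c"
    "Transposition.transpose 3 4 = ?k"
    by (simp_all add: fun_eq_iff Transposition.transpose_def)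
  have less: "Transposition.transpose a b \<in> generate ?G {?c, ?r, ?k}"
    if "a \<in> {1..4}" "b \<in> {1..4}" "a < b" for a b :: nat
  proof -
    have "(a, b) \<in> {(1, 2), (1, 3), (1, 4), (2, 3), (2, 4), (3, 4)}"
      using that unfolding S by auto
    then show ?thesis
      by (elim insertE emptyE Pair_inject; hypsubst; unfold words; intro mult gen)
  qed
  show "carrier ?G \<subseteq> generate ?G {?c, ?r, ?k}"
  proof
    fix p assume "p \<in> carrier ?G"
    then have "p permutes {1..4}" by (simp add: sym_group_carrier)
    from this finite_atLeastAtMost show "p \<in> generate ?G {?c, ?r, ?k}"
    proof (induction rule: permutes_induct)
      case id
      show ?case using generate.one[of ?G] by (simp only: sym_group_one)
    next
      case (swap a b p)
      \<comment> \<open>The two points are distinct and a transposition is symmetric in them, so the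
        case of increasing order suffices.\<close>
      have "Transposition.transpose a b \<in> generate ?G {?c, ?r, ?k}"
        using less[of a b] less[of b a] swap(1-3) by (metis linorder_neqE_nat transpose_commute)
      then show ?case using swap by (intro mult)
    qed
  qed
qed

text \<open>Links the two prescriptions: the 4-cycle, where the second representation is given,
  becomes a word in permutations where the first one is given.\<close>

lemma cycle_1243_word:
  "cycle_of_list [1, 2, 4, 3::nat]
    = cycle_of_list [1, 2] \<circ> cycle_of_list [3, 4] \<circ> cycle_of_list [2, 3, 4] \<circ> cycle_of_list [3, 4]"
  by (simp add: fun_eq_iff Transposition.transpose_def)

text \<open>The double transposition and the transposition (34) are words in the 3-cycle and the
  4-cycle, which reduces the claim to the previous generating set.\<close>

lemma generate_sym_group_4_rho2:
  "generate (sym_group 4) {cycle_of_list [2, 3, 4], cycle_of_list [1, 2, 4, 3]}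
    = carrier (sym_group 4)"
  (is "generate ?G {?c, ?f} = _")
proof
  let ?r = "cycle_of_list [1, 2] \<circ> cycle_of_list [3, 4] :: nat \<Rightarrow> nat"
    and ?k = "cycle_of_list [3, 4] :: nat \<Rightarrow> nat"
  have carr: "{?c, ?f} \<subseteq> carrier ?G"
    by (auto simp: sym_group_carrier intro!: permutes_compose permutes_swap_id)
  then show "generate ?G {?c, ?f} \<subseteq> carrier ?G"
    by (rule group.generate_incl[OF sym_group_is_group])
  have gen: "?c \<in> generate ?G {?c, ?f}" "?f \<in> generate ?G {?c, ?f}"
    by (rule generate.incl, blast)+
  have mult: "x \<circ> y \<in> generate ?G {?c, ?f}"
    if "x \<in> generate ?G {?c, ?f}" "y \<in> generate ?G {?c, ?f}" for x y
    using generate.eng[OF that] by (simp only: sym_group_mult)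
  have c: "?c x = (if x = 2 then 3 else if x = 3 then 4 else if x = 4 then 2 else x)" for x
    by (simp add: Transposition.transpose_def)
  have f: "?f x = (if x = 1 then 2 else if x = 2 then 4 else if x = 4 then 3 else if x = 3 then 1 else x)" for x
    by (simp add: Transposition.transpose_def)
  have r: "?r x = (if x = 1 then 2 else if x = 2 then 1 else if x = 3 then 4 else if x = 4 then 3 else x)" for x
    by (simp add: Transposition.transpose_def)
  have k: "?k x = (if x = 3 then 4 else if x = 4 then 3 else x)" for x
    by (simp add: Transposition.transpose_def)
  \<comment> \<open>The square of the 4-cycle is (14)(23), and conjugating by the 3-cycle, with
    inverse \<open>?c \<circ> ?c\<close>, gives (12)(34). Composition is unfolded only at inner
    factors \<open>?c\<close> and \<open>?f\<close>, since \<open>?r\<close> is itself a composite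
    and must stay whole for its table \<open>r\<close> to apply.\<close>
  have "?r = ?c \<circ> ?f \<circ> ?f \<circ> ?c \<circ> ?c"
    by (rule ext, unfold o_apply[of _ ?c] o_apply[of _ ?f] c f r) simp
  then have "?r \<in> generate ?G {?c, ?f}"
    using gen mult by metis
  \<comment> \<open>Applying in turn f, the inverse of c and the square of f sends 3 through 1, 1 to
    4, and 4 through 3, 2 to 3.\<close>
  moreover have "?k = ?f \<circ> ?f \<circ> ?c \<circ> ?c \<circ> ?f"
    by (rule ext, unfold o_apply[of _ ?c] o_apply[of _ ?f] c f k) simp
  then have "?k \<in> generate ?G {?c, ?f}"
    using gen mult by metis
  ultimately have "generate ?G {?c, ?r, ?k} \<subseteq> generate ?G {?c, ?f}"
    using gen carr
    by (intro group.generate_subgroup_incl[OF sym_group_is_group]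
        group.generate_is_subgroup[OF sym_group_is_group]) blast+
  then show "carrier ?G \<subseteq> generate ?G {?c, ?f}"
    by (simp only: generate_sym_group_4_rho1)
qed


section \<open>The representations\<close>

text \<open>Homomorphisms commute with generation, so the values prescribed on generators fix the
  whole image.\<close>

lemma rep_image_generate:
  assumes "is_matrix_rep G \<rho>" "S \<subseteq> carrier G" "generate G S = carrier G"
  shows "\<rho> ` carrier G = generate GL_group (\<rho> ` S)"
proof -
  interpret group_hom G GL_group \<rho>
    using assms(1) by (simp add: group_hom_def group_hom_axioms_def is_matrix_rep_def group_GL_group)
  show ?thesis using generate_img[OF assms(2)] assms(3) by simp
qed

lemma rho1_image:
  assumes "is_rho1 \<rho>"
  shows "\<rho> ` carrier (sym_group 4) = tetra_kappa"
proof -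
  have "{cycle_of_list [2, 3, 4], cycle_of_list [1, 2] \<circ> cycle_of_list [3, 4],
     cycle_of_list [3, 4]} \<subseteq> carrier (sym_group 4)"
    unfolding generate_sym_group_4_rho1[symmetric] by (blast intro: generate.incl)
  from rep_image_generate[OF _ this generate_sym_group_4_rho1, of \<rho>] assms
  show ?thesis unfolding is_rho1_def tetra_kappa_def image_insert image_empty
    by (simp only: insert_commute)
qed

lemma rho2_image:
  assumes "is_rho2 \<rho>"
  shows "\<rho> ` carrier (sym_group 4) = octa"
proof -
  have "{cycle_of_list [2, 3, 4], cycle_of_list [1, 2, 4, 3]} \<subseteq> carrier (sym_group 4)"
    unfolding generate_sym_group_4_rho2[symmetric] by (blast intro: generate.incl)
  from rep_image_generate[OF _ this generate_sym_group_4_rho2, of \<rho>] assms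
  show ?thesis unfolding is_rho2_def octa_def image_insert image_empty by (simp only:)
qed

lemma matrix_rep_GL:
  assumes "is_matrix_rep G \<rho>" "x \<in> carrier G"
  shows "invertible (\<rho> x)"
  using assms by (auto simp: is_matrix_rep_def hom_def GL_group_simps)

lemma matrix_rep_mult:
  assumes "is_matrix_rep G \<rho>" "x \<in> carrier G" "y \<in> carrier G"
  shows "\<rho> (x \<otimes>\<^bsub>G\<^esub> y) = \<rho> x ** \<rho> y"
  using assms by (auto simp: is_matrix_rep_def hom_def GL_group_simps)

lemma matrix_rep_one:
  assumes "is_matrix_rep G \<rho>"
  shows "\<rho> \<one>\<^bsub>G\<^esub> = mat 1"
  using assms hom_one[of \<rho> G GL_group]
  by (simp add: is_matrix_rep_def group_GL_group GL_group_simps)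

section \<open>Extending a representation by the circle\<close>

lemma extend_rep_matrix_rep:
  assumes "is_matrix_rep (sym_group 4) \<rho>"
  shows "is_matrix_rep S4_circle (extend_rep \<rho>)"
proof -
  have "extend_rep \<rho> (x \<otimes>\<^bsub>S4_circle\<^esub> y) = extend_rep \<rho> x ** extend_rep \<rho> y"
    if "x \<in> carrier S4_circle" "y \<in> carrier S4_circle" for x y
  proof -
    obtain \<delta> \<theta> \<delta>' \<theta>' where xy: "x = (\<delta>, \<theta>)" "y = (\<delta>', \<theta>')" by fastforce
    \<comment> \<open>Multiplicativity rests on scalars being central; the reduction of angles in
      \<open>circle_group\<close> is absorbed by the periodicity of \<open>cis\<close>.\<close>
    have "mat (cis (\<theta> + \<theta>')) ** (\<rho> \<delta> ** \<rho> \<delta>')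
      = mat (cis \<theta>) ** (mat (cis \<theta>') ** \<rho> \<delta>) ** \<rho> \<delta>'"
      by (simp add: matrix_mul_assoc mat_mult_mat cis_mult)
    also have "\<dots> = (mat (cis \<theta>) ** \<rho> \<delta>) ** (mat (cis \<theta>') ** \<rho> \<delta>')"
      by (simp only: mat_mult_commute[of "cis \<theta>'" "\<rho> \<delta>"] matrix_mul_assoc)
    finally show ?thesis
      using matrix_rep_mult[OF assms, of \<delta> \<delta>'] that
      by (simp add: xy extend_rep_def circle_group_def)
  qed
  moreover have "invertible (extend_rep \<rho> x)" if "x \<in> carrier S4_circle" for x
    using that matrix_rep_GL[OF assms]
    by (auto simp: extend_rep_def intro!: invertible_mult invertible_mat_cis)
  ultimately show ?thesis
    by (auto simp: is_matrix_rep_def hom_def GL_group_simps DirProd_group sym_group_is_group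
        group_circle_group simp del: carrier_DirProd mult_DirProd)
qed

text \<open>Values are products of a scalar and a matrix of the original image. Conversely, the
  image is a subgroup that contains the original image (angle 0) and all scalars (identity
  permutation).\<close>

lemma extend_rep_image:
  assumes "is_matrix_rep (sym_group 4) \<rho>"
  shows "extend_rep \<rho> ` carrier S4_circle = adjoin_circle (\<rho> ` carrier (sym_group 4))"
proof
  show "extend_rep \<rho> ` carrier S4_circle \<subseteq> adjoin_circle (\<rho> ` carrier (sym_group 4))"
    using subset_adjoin_circle[of "\<rho> ` carrier (sym_group 4)"]
    by (auto simp: extend_rep_def circle_group_def
        intro!: adjoin_circle_mult mat_cis_in_adjoin_circle)
  interpret group_hom S4_circle GL_group "extend_rep \<rho>"
    using extend_rep_matrix_rep[OF assms]
    by (simp add: group_hom_def group_hom_axioms_def is_matrix_rep_def group_GL_group)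
  show "adjoin_circle (\<rho> ` carrier (sym_group 4)) \<subseteq> extend_rep \<rho> ` carrier S4_circle"
  proof (rule adjoin_circle_subset[OF img_is_subgroup])
    show "\<rho> ` carrier (sym_group 4) \<subseteq> extend_rep \<rho> ` carrier S4_circle"
    proof (rule image_subsetI)
      fix \<delta> assume "\<delta> \<in> carrier (sym_group 4)"
      then have "(\<delta>, 0) \<in> carrier S4_circle" "extend_rep \<rho> (\<delta>, 0) = \<rho> \<delta>"
        by (simp_all add: circle_group_def extend_rep_def)
      then show "\<rho> \<delta> \<in> extend_rep \<rho> ` carrier S4_circle" by (metis imageI)
    qed
    fix \<theta> :: real
    \<comment> \<open>An arbitrary angle is first reduced to its representative in
      \<open>circle_group\<close>, which leaves the scalar unchanged.\<close>
    have "(\<one>\<^bsub>sym_group 4\<^esub>, \<theta> rmod (2 * pi)) \<in> carrier S4_circle"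
      by (simp add: circle_group_def rmod_nonneg rmod_less group.is_monoid[OF sym_group_is_group]
          monoid.one_closed)
    moreover have "extend_rep \<rho> (\<one>\<^bsub>sym_group 4\<^esub>, \<theta> rmod (2 * pi)) = mat (cis \<theta>)"
      using matrix_rep_one[OF assms] by (simp add: extend_rep_def)
    ultimately show "mat (cis \<theta>) \<in> extend_rep \<rho> ` carrier S4_circle" by (metis imageI)
  qed
qed

section \<open>Characters and inequivalence\<close>

lemma equivalent_reps_trace:
  assumes "equivalent_reps G \<rho> \<sigma>" "g \<in> carrier G"
  shows "trace (\<rho> g) = trace (\<sigma> g)"
proof -
  from assms obtain L L' where L: "L ** L' = mat 1" "L' ** L = mat 1" "L ** \<rho> g = \<sigma> g ** L"
    unfolding equivalent_reps_def invertible_def by blast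
  have "trace (\<rho> g) = trace (L' ** (L ** \<rho> g))"
    by (simp add: matrix_mul_assoc L(2))
  \<comment> \<open>Cyclic invariance of the trace moves \<open>L'\<close> to the right, where it
    cancels the intertwiner.\<close>
  also have "\<dots> = trace (\<sigma> g ** (L ** L'))"
    by (subst trace_mul_sym) (simp add: L(3) matrix_mul_assoc)
  finally show ?thesis by (simp add: L(1))
qed

text \<open>The real form of a complex intertwiner is a real intertwiner. Hence inequivalence over
  the reals implies inequivalence over the complex numbers.\<close>

lemma equivalent_reps_realify:
  assumes "equivalent_reps G \<rho> \<sigma>"
  shows "equivalent_reps G (realify \<circ> \<rho>) (realify \<circ> \<sigma>)"
proof -
  obtain L where "invertible L" "\<forall>g\<in>carrier G. L ** \<rho> g = \<sigma> g ** L"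
    using assms unfolding equivalent_reps_def by blast
  then show ?thesis
    unfolding equivalent_reps_def
    by (intro exI[of _ "realify L"]) (simp add: invertible_realify flip: realify_mult)
qed

lemma rho1_cycle_1243:
  assumes "is_rho1 \<rho>"
  shows "\<rho> (cycle_of_list [1, 2, 4, 3]) = cmat (R_mat ** C_mat ** kappa_mat)"
proof -
  let ?c = "cycle_of_list [2, 3, 4] :: nat \<Rightarrow> nat" and ?k = "cycle_of_list [3, 4] :: nat \<Rightarrow> nat"
    and ?r = "cycle_of_list [1, 2] \<circ> cycle_of_list [3, 4] :: nat \<Rightarrow> nat"
  note \<rho> = assms[unfolded is_rho1_def]
  have mem: "?c \<in> carrier (sym_group 4)" "?r \<in> carrier (sym_group 4)" "?k \<in> carrier (sym_group 4)"
    unfolding generate_sym_group_4_rho1[symmetric] by (rule generate.incl, blast)+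
  have rc: "?r \<circ> ?c \<in> carrier (sym_group 4)"
    using mem monoid.m_closed[OF group.is_monoid[OF sym_group_is_group], of ?r 4 ?c]
    by (simp only: sym_group_mult)
  have "\<rho> (?r \<circ> ?c \<circ> ?k) = \<rho> ?r ** \<rho> ?c ** \<rho> ?k"
    using matrix_rep_mult[OF conjunct1[OF \<rho>] rc mem(3)]
      matrix_rep_mult[OF conjunct1[OF \<rho>] mem(2,1)]
    by (simp only: sym_group_mult)
  then show ?thesis
    using \<rho> unfolding cycle_1243_word by (simp only: cmat_mult)
qed

lemma extend_reps_not_equivalent:
  assumes "is_rho1 \<rho>1" "is_rho2 \<rho>2"
  shows "\<not> equivalent_reps S4_circle (realify \<circ> extend_rep \<rho>1) (realify \<circ> extend_rep \<rho>2)"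
proof
  \<comment> \<open>The characters agree on even permutations and are opposite on odd ones, so the
    witness is odd; angle 0 makes the scalar trivial.\<close>
  let ?g = "(cycle_of_list [1, 2, 4, 3], 0) :: (nat \<Rightarrow> nat) \<times> real"
  assume eq: "equivalent_reps S4_circle (realify \<circ> extend_rep \<rho>1) (realify \<circ> extend_rep \<rho>2)"
  have "cycle_of_list [1, 2, 4, 3] \<in> carrier (sym_group 4)"
    unfolding generate_sym_group_4_rho2[symmetric] by (rule generate.incl) blast
  then have "?g \<in> carrier S4_circle" by (simp add: circle_group_def)
  from equivalent_reps_trace[OF eq this]
  have "Re (trace (\<rho>1 (cycle_of_list [1, 2, 4, 3]))) = Re (trace (\<rho>2 (cycle_of_list [1, 2, 4, 3])))"
    by (simp add: extend_rep_def trace_realify del: cycle_of_list.simps)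
  moreover have "\<rho>2 (cycle_of_list [1, 2, 4, 3]) = cmat T_mat"
    using assms(2) by (simp only: is_rho2_def)
  ultimately have "Re (trace (cmat (R_mat ** C_mat ** kappa_mat))) = Re (trace (cmat T_mat))"
    using rho1_cycle_1243[OF assms(1)] by metis
  then show False by (simp add: trace_def map_matrix_def mat3_simps)
qed

theorem mainTheorem4:
  shows "(subgroup (realify ` adjoin_circle tetra_kappa) (orthogonal_group :: (real ^ (3 + 3) ^ (3 + 3)) monoid)
      \<and> subgroup (realify ` adjoin_circle octa) orthogonal_group
      \<and> subgroup (realify ` adjoin_circle octa_minus) orthogonal_group
      \<and> realify ` adjoin_circle tetra_kappa = realify ` adjoin_circle octa
      \<and> realify ` adjoin_circle octa = realify ` adjoin_circle octa_minus)
    \<and> (\<forall>\<rho>1 \<rho>2. is_rho1 \<rho>1 \<and> is_rho2 \<rho>2 \<longrightarrow>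
        is_matrix_rep S4_circle (extend_rep \<rho>1)
      \<and> is_matrix_rep S4_circle (extend_rep \<rho>2)
      \<and> extend_rep \<rho>1 ` carrier S4_circle = adjoin_circle tetra_kappa
      \<and> extend_rep \<rho>2 ` carrier S4_circle = adjoin_circle octa
      \<and> \<not> equivalent_reps S4_circle (extend_rep \<rho>1) (extend_rep \<rho>2)
      \<and> \<not> equivalent_reps S4_circle (realify \<circ> extend_rep \<rho>1) (realify \<circ> extend_rep \<rho>2))"
proof (intro conjI allI impI; (elim conjE)?)
  show "realify ` adjoin_circle tetra_kappa = realify ` adjoin_circle octa"
    "realify ` adjoin_circle octa = realify ` adjoin_circle octa_minus"
    by (simp_all only: adjoin_circle_tetra_kappa adjoin_circle_octa_minus)
  have sub: "subgroup (realify ` adjoin_circle \<Gamma>) orthogonal_group"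
    if "\<Gamma> \<subseteq> unitary_matrices" for \<Gamma> :: "(complex ^ 3 ^ 3) set"
    using that unitary_subset_GL
    by (intro subgroup_realify_image subgroup_adjoin_circle adjoin_circle_unitary) auto
  show "subgroup (realify ` adjoin_circle tetra_kappa) orthogonal_group"
    "subgroup (realify ` adjoin_circle octa) orthogonal_group"
    "subgroup (realify ` adjoin_circle octa_minus) orthogonal_group"
    by (intro sub groups_unitary)+
next
  fix \<rho>1 \<rho>2
  assume \<rho>: "is_rho1 \<rho>1" "is_rho2 \<rho>2"
  then have rep: "is_matrix_rep (sym_group 4) \<rho>1" "is_matrix_rep (sym_group 4) \<rho>2"
    by (simp_all only: is_rho1_def is_rho2_def)
  show "is_matrix_rep S4_circle (extend_rep \<rho>1)" "is_matrix_rep S4_circle (extend_rep \<rho>2)"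
    by (rule extend_rep_matrix_rep rep)+
  show "extend_rep \<rho>1 ` carrier S4_circle = adjoin_circle tetra_kappa"
    "extend_rep \<rho>2 ` carrier S4_circle = adjoin_circle octa"
    using extend_rep_image[OF rep(1)] extend_rep_image[OF rep(2)] \<rho>
    by (simp_all only: rho1_image rho2_image)
  show "\<not> equivalent_reps S4_circle (realify \<circ> extend_rep \<rho>1) (realify \<circ> extend_rep \<rho>2)"
    by (rule extend_reps_not_equivalent[OF \<rho>])
  then show "\<not> equivalent_reps S4_circle (extend_rep \<rho>1) (extend_rep \<rho>2)"
    using equivalent_reps_realify by blast
qed

end
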